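(* Let $\Pi$ be a discrete probability distribution with support $\{s_i:i\in\mathbb{N}\}$, $0<s_1<s_2<\cdots$, probabilities $\pi_i=\Pi(\{s_i\})$, $\sum_{i\ge 1}\pi_i=1$; let $\xi\ge1$ be an integer, $G_m\sim\mathrm{Erlang}(\xi,\xi)$, and let $\gamma>0$, $\mu_F>0$ with $\rho=\gamma\mu_F<1$. Let $N_1,N_2\in\mathbb{N}$ be truncation levels, $S\sim\Pi$, and $\varepsilon_1=\mathbb{P}(S>s_{N_2})$. Then for all $u\ge0$ $$\psi_{\Pi\star G_m}(u)-\widetilde\psi_{\Pi\star G_m}(u)\le\varepsilon_1\left[\frac{\gamma\mu_F}{1-\gamma\mu_F}\left(\frac{\xi u}{s_1}\right)+\frac{2}{(1-\gamma\mu_F)^2}\,e^{-\frac{(1-\gamma\mu_F)\xi u}{s_1}}\right]+\big(1-\zeta(N_1;\xi u/s_1)\big),$$ where $\zeta(N_1;\xi u/s_1)$ denotes the cumulative distribution function of a Poisson distribution with parameter $\xi u/s_1$ evaluated at $N_1$, and $\widetilde\psi_{\Pi\star G_m}$ is the truncated approximation $$\widetilde\psi_{\Pi\star G_m}(u)=e^{-\xi u/s_1}\sum_{n=0}^{N_1}\widetilde\kappa_n\frac{(\xi u)^n}{s_1^n n!}$$ with $$\widetilde\kappa_n=\begin{cases}\gamma\mu_F,&0\le n\le\xi-1,\\ \gamma\mu_F\left[\displaystyle\sum_{i=\xi-1}^{n-1}\widetilde\kappa_{n-1-i}\widetilde{\mathcal{B}}_i+\widetilde{\mathcal{C}}_n\right],&\xi\le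 n\le N_1,\end{cases}$$ $$\widetilde{\mathcal{B}}_i=\frac{\xi}{i+1}\sum_{j=1}^{N_2}\pi_j\,\mathrm{bin}(\xi;i+1,s_1/s_j),\qquad\widetilde{\mathcal{C}}_n=\sum_{j=1}^{N_2}\pi_j\,\mathrm{Bin}(\xi-1;n,s_1/s_j).$$
   Context: $\mathrm{Erlang}(\xi,\xi)$ is the Gamma distribution with shape $\xi$ and rate $\xi$. $\Pi\star G(u)=\int_0^\infty G(u/s)\,d\Pi(s)$. For a distribution $H$ on $[0,\infty)$, $\psi_H(u):=(1-\rho)\sum_{n=1}^\infty\rho^n(1-H^{*n}(u))$, with $H^{*n}$ the $n$-fold additive convolution. The exact quantity has the series expansion $\psi_{\Pi\star G_m}(u)=\sum_{n=0}^\infty\kappa_n\frac{(\xi u/s_1)^n e^{-\xi u/s_1}}{n!}$, where $\kappa_n=\gamma\mu_F$ for $0\le n\le\xi-1$, $\kappa_n=\gamma\mu_F[\sum_{i=\xi-1}^{n-1}\kappa_{n-1-i}\mathcal{B}_i+\mathcal{C}_n]$ for $n\ge\xi$, and $\mathcal{B}_i=\sum_{j=1}^\infty\frac{\pi_js_1}{s_j}\mathrm{bin}(\xi-1;i,s_1/s_j)$, $\mathcal{C}_n=\sum_{j=1}^\infty\pi_j\mathrm{Bin}(\xi-1;n,s_1/s_j)$; the truncation keeps $N_2$ terms in the series over $j$ and the terms $n\le N_1$. $\mathrm{bin}(\cdot;n,p)$ and $\mathrm{Bin}(\cdot;n,p)$ are the probability mass function and the cumulative distribution function of the binomial distribution with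 parameters $n,p$. Convention $0^0=1$. *)

theory Defs
  imports "HOL-Probability.Probability"
begin

text \<open>
  Distributions \<open>G\<close>, \<open>H\<close> on the real line are given by their distribution functions;
  \<^const>\<open>interval_measure\<close> recovers the associated Lebesgue--Stieltjes measure.
\<close>

text \<open>
  Distribution function of the Erlang distribution with shape \<open>k \<ge> 1\<close> and rate \<open>l\<close>.  The library's
  \<^const>\<open>erlang_density\<close> takes the shape minus one as its first argument.
\<close>

definition Erlang :: "nat \<Rightarrow> real \<Rightarrow> real \<Rightarrow> real" where
  "Erlang k l = cdf (density lborel (erlang_density (k - 1) l))"

text \<open>Multiplicative (Mellin--Stieltjes) convolution of a distribution on the positive half-line
  with a distribution function.\<close>

definition mellin_conv :: "real measure \<Rightarrow> (real \<Rightarrow> real) \<Rightarrow> real \<Rightarrow> real" where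
  "mellin_conv P G u = (LINT s:{0<..}|P. G (u / s))"

primrec conv_power :: "real measure \<Rightarrow> nat \<Rightarrow> real measure" where
  "conv_power M 0 = return borel 0"
| "conv_power M (Suc n) = convolution M (conv_power M n)"

definition psi :: "real \<Rightarrow> (real \<Rightarrow> real) \<Rightarrow> real \<Rightarrow> real" where
  "psi \<rho> H u = (1 - \<rho>) * (\<Sum>n. \<rho> ^ Suc n * (1 - cdf (conv_power (interval_measure H) (Suc n)) u))"

definition bin_pmf :: "nat \<Rightarrow> nat \<Rightarrow> real \<Rightarrow> real" where
  "bin_pmf k n p = pmf (binomial_pmf n p) k"

definition bin_cdf :: "nat \<Rightarrow> nat \<Rightarrow> real \<Rightarrow> real" where
  "bin_cdf k n p = measure_pmf.prob (binomial_pmf n p) {..k}"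

text \<open>
  The library's \<^const>\<open>poisson_pmf\<close> is specified for positive rates only.  The explicit sum also
  covers rate \<open>0\<close>, where (by \<open>0 ^ 0 = 1\<close>) it gives the unit mass at \<open>0\<close>.
\<close>

definition poisson_cdf :: "nat \<Rightarrow> real \<Rightarrow> real" where
  "poisson_cdf N r = (\<Sum>k\<le>N. r ^ k / fact k * exp (- r))"

lemma poisson_cdf_eq_prob:
  assumes "r > 0"
  shows "poisson_cdf N r = measure_pmf.prob (poisson_pmf r) {..N}"
  using assms by (simp add: poisson_cdf_def measure_measure_pmf_finite)

text \<open>
  Below, \<open>s j\<close> for \<open>j \<ge> 1\<close> enumerates the support of \<open>P\<close>, so \<open>\<pi>\<^sub>j\<close> is \<open>pmf P (s j)\<close>; the value
  \<open>s 0\<close> plays no role.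
\<close>

definition B_trunc :: "real pmf \<Rightarrow> (nat \<Rightarrow> real) \<Rightarrow> nat \<Rightarrow> nat \<Rightarrow> nat \<Rightarrow> real" where
  "B_trunc P s \<xi> N2 i =
     real \<xi> / real (i + 1) * (\<Sum>j = 1..N2. pmf P (s j) * bin_pmf \<xi> (i + 1) (s 1 / s j))"

definition C_trunc :: "real pmf \<Rightarrow> (nat \<Rightarrow> real) \<Rightarrow> nat \<Rightarrow> nat \<Rightarrow> nat \<Rightarrow> real" where
  "C_trunc P s \<xi> N2 n =
     (\<Sum>j = 1..N2. pmf P (s j) * bin_cdf (\<xi> - 1) n (s 1 / s j))"

text \<open>The range \<open>{\<xi> - 1..<n}\<close> is \<open>\<xi> - 1 \<le> i \<le> n - 1\<close>, written so as to avoid truncated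
  subtraction at \<open>n = 0\<close>.\<close>

function kappa_trunc :: "real \<Rightarrow> real pmf \<Rightarrow> (nat \<Rightarrow> real) \<Rightarrow> nat \<Rightarrow> nat \<Rightarrow> nat \<Rightarrow> real" where
  "kappa_trunc \<rho> P s \<xi> N2 n =
     (if n < \<xi> then \<rho>
      else \<rho> * ((\<Sum>i\<in>{\<xi> - 1..<n}. kappa_trunc \<rho> P s \<xi> N2 (n - 1 - i) * B_trunc P s \<xi> N2 i)
                + C_trunc P s \<xi> N2 n))"
  by pat_completeness auto
termination
  by (relation "Wellfounded.measure (\<lambda>(\<rho>, P, s, \<xi>, N2, n). n)") auto

declare kappa_trunc.simps [simp del]

definition psi_trunc :: "real \<Rightarrow> real pmf \<Rightarrow> (nat \<Rightarrow> real) \<Rightarrow> nat \<Rightarrow> nat \<Rightarrow> nat \<Rightarrow> real \<Rightarrow> real" where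
  "psi_trunc \<rho> P s \<xi> N1 N2 u =
     exp (- (real \<xi> * u / s 1)) *
     (\<Sum>n\<le>N1. kappa_trunc \<rho> P s \<xi> N2 n * ((real \<xi> * u) ^ n / (s 1 ^ n * fact n)))"

end

theory Submission
  imports Defs
begin

text \<open>
  Put \<open>\<lambda> = \<xi> / s\<^sub>1\<close>.  Since \<open>s\<^sub>1\<close> is the smallest atom, each Erlang component of \<open>\<Pi> \<star> G\<^sub>m\<close> is a
  negative binomial mixture of Erlang distributions of the common rate \<open>\<lambda>\<close>, hence so are all
  convolution powers, and \<open>\<psi>(u)\<close> is the Poisson average, with parameter \<open>\<lambda> u\<close>, of the tails
  \<open>\<kappa>\<^sub>n\<close> of a geometric compound of integer variables.  These tails satisfy the renewal equation whose
  truncation defines \<open>kappa_trunc\<close>, and by induction the two solutions differ by at most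
  \<open>\<epsilon>\<^sub>1 \<rho> / (1 - \<rho>)\<close>.  The claimed bound is weaker: with \<open>x = \<lambda> u\<close> it suffices that
  \<open>\<rho> / (1 - \<rho>) (1 - x) \<le> 2 / (1 - \<rho>)\<^sup>2 exp (- (1 - \<rho>) x)\<close>.
\<close>

section \<open>Mixtures of Erlang distributions with a common rate\<close>

lemma nn_integral_nat_pmf:
  "(\<integral>\<^sup>+ i. f i \<partial>measure_pmf A) = (\<Sum>i. ennreal (pmf A i) * f i)" for A :: "nat pmf"
  by (simp add: nn_integral_measure_pmf nn_integral_count_space_nat)

text \<open>Integration over a law on the naturals is a series, so monotone convergence gives the
  interchange for any measure \<open>M\<close>.\<close>

lemma nn_integral_nat_pmf_swap:
  fixes A :: "nat pmf"
  assumes [measurable]: "\<And>i. f i \<in> borel_measurable M"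
  shows "(\<integral>\<^sup>+ x. \<integral>\<^sup>+ i. f i x \<partial>measure_pmf A \<partial>M) = (\<integral>\<^sup>+ i. \<integral>\<^sup>+ x. f i x \<partial>M \<partial>measure_pmf A)"
  by (simp add: nn_integral_nat_pmf nn_integral_suminf nn_integral_cmult)

text \<open>The index \<open>i\<close> is the shape minus one, as in \<open>erlang_density\<close>:
  \<open>A\<close> is the law of the number of exponential stages of rate \<open>l\<close>, less
  one.\<close>

definition erlang_mixture :: "real \<Rightarrow> nat pmf \<Rightarrow> real measure" where
  "erlang_mixture l A = measure_pmf A \<bind> (\<lambda>i. density lborel (erlang_density i l))"

lemma erlang_kernel_measurable [measurable]:
  assumes "0 < l"
  shows "(\<lambda>i. density lborel (erlang_density i l)) \<in> measurable (measure_pmf A) (subprob_algebra borel)"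
proof -
  have "density lborel (erlang_density i l) \<in> space (subprob_algebra borel)" for i
    unfolding space_subprob_algebra
    using prob_space_imp_subprob_space[OF prob_space_erlang_density[OF assms, of i]] by simp
  then show ?thesis by simp
qed

lemma
  assumes "0 < l"
  shows sets_erlang_mixture [simp]: "sets (erlang_mixture l A) = sets borel"
    and space_erlang_mixture [simp]: "space (erlang_mixture l A) = UNIV"
  unfolding erlang_mixture_def by (simp_all add: sets_bind[where N=borel] space_bind[where N=borel])

lemma prob_space_erlang_mixture:
  assumes "0 < l"
  shows "prob_space (erlang_mixture l A)"
  unfolding erlang_mixture_def
  using prob_space_erlang_density[OF assms]
  by (intro measure_pmf.prob_space_bind[OF _ erlang_kernel_measurable[OF assms]]) simp

lemma nn_integral_erlang_mixture:
  assumes "0 < l" "f \<in> borel_measurable borel"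
  shows "(\<integral>\<^sup>+ x. f x \<partial>erlang_mixture l A)
    = (\<integral>\<^sup>+ i. \<integral>\<^sup>+ x. f x \<partial>density lborel (erlang_density i l) \<partial>measure_pmf A)"
  unfolding erlang_mixture_def
  by (rule nn_integral_bind[OF assms(2) erlang_kernel_measurable[OF assms(1)]])

lemma emeasure_erlang_mixture:
  assumes "0 < l" "X \<in> sets borel"
  shows "emeasure (erlang_mixture l A) X
    = (\<integral>\<^sup>+ i. emeasure (density lborel (erlang_density i l)) X \<partial>measure_pmf A)"
  unfolding erlang_mixture_def
  by (rule emeasure_bind[OF _ erlang_kernel_measurable[OF assms(1)] assms(2)]) simp

lemma cdf_erlang:
  assumes "0 < l"
  shows "cdf (density lborel (erlang_density i l)) u = erlang_CDF i l u"
  using assms by (simp add: cdf_def measure_def emeasure_erlang_density)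

lemma cdf_erlang_mixture:
  assumes "0 < l"
  shows "cdf (erlang_mixture l A) u = measure_pmf.expectation A (\<lambda>i. erlang_CDF i l u)"
proof -
  have "cdf (erlang_mixture l A) u
      = measure_pmf.expectation A (\<lambda>i. measure (density lborel (erlang_density i l)) {..u})"
    unfolding erlang_mixture_def cdf_def
    by (rule measure_pmf.measure_bind[OF erlang_kernel_measurable[OF assms]]) simp
  then show ?thesis
    using cdf_erlang[OF assms] by (simp add: cdf_def)
qed

lemma convolution_erlang:
  assumes l: "0 < l"
  shows "convolution (density lborel (erlang_density i l)) (density lborel (erlang_density j l))
    = density lborel (erlang_density (Suc (i + j)) l)"
proof -
  interpret i: prob_space "density lborel (erlang_density i l)" by (rule prob_space_erlang_density[OF l])
  interpret j: prob_space "density lborel (erlang_density j l)" by (rule prob_space_erlang_density[OF l])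
  show ?thesis
    by (subst convolution_density)
       (use convolution_erlang_density[OF l, of i j]
        in \<open>simp_all add: i.finite_measure_axioms j.finite_measure_axioms l less_imp_le\<close>)
qed

text \<open>Convolution is linear in each factor and so acts component by component. Shapes add at a
  common rate, and the shape \<open>(i + 1) + (j + 1)\<close> has index
  \<open>Suc (i + j)\<close>.\<close>

lemma convolution_erlang_mixture:
  assumes l: "0 < l"
  shows "convolution (erlang_mixture l A) (erlang_mixture l B)
    = erlang_mixture l (bind_pmf A (\<lambda>i. map_pmf (\<lambda>j. Suc (i + j)) B))"
proof (rule measure_eqI)
  show "sets (convolution (erlang_mixture l A) (erlang_mixture l B))
      = sets (erlang_mixture l (bind_pmf A (\<lambda>i. map_pmf (\<lambda>j. Suc (i + j)) B)))"
    using l by simp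
next
  let ?E = "\<lambda>i. density lborel (erlang_density i l)"
  fix X assume "X \<in> sets (convolution (erlang_mixture l A) (erlang_mixture l B))"
  then have X [measurable]: "X \<in> sets borel" by simp
  interpret A: prob_space "erlang_mixture l A" by (rule prob_space_erlang_mixture[OF l])
  interpret B: prob_space "erlang_mixture l B" by (rule prob_space_erlang_mixture[OF l])
  interpret E: prob_space "?E i" for i by (rule prob_space_erlang_density[OF l])
  have "emeasure (convolution (erlang_mixture l A) (erlang_mixture l B)) X
      = (\<integral>\<^sup>+ x. \<integral>\<^sup>+ y. indicator X (x + y) \<partial>erlang_mixture l B \<partial>erlang_mixture l A)"
    using l by (subst convolution_emeasure')
      (simp_all add: A.finite_measure_axioms B.finite_measure_axioms)
  \<comment> \<open>The mixture in the inner variable is expanded and its sum moved outside; then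
    the same is done for the outer variable, until a convolution of two pure Erlang laws
    remains.\<close>
  also have "\<dots> = (\<integral>\<^sup>+ x. \<integral>\<^sup>+ j. \<integral>\<^sup>+ y. indicator X (x + y) \<partial>?E j \<partial>B \<partial>erlang_mixture l A)"
    by (intro nn_integral_cong nn_integral_erlang_mixture l) simp
  also have "\<dots> = (\<integral>\<^sup>+ j. \<integral>\<^sup>+ x. \<integral>\<^sup>+ y. indicator X (x + y) \<partial>?E j \<partial>erlang_mixture l A \<partial>B)"
    by (intro nn_integral_nat_pmf_swap) (use l in \<open>simp cong: measurable_cong_sets\<close>)
  also have "\<dots> = (\<integral>\<^sup>+ j. \<integral>\<^sup>+ i. \<integral>\<^sup>+ x. \<integral>\<^sup>+ y. indicator X (x + y) \<partial>?E j \<partial>?E i \<partial>A \<partial>B)"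
    by (intro nn_integral_cong nn_integral_erlang_mixture l) simp
  also have "\<dots> = (\<integral>\<^sup>+ i. \<integral>\<^sup>+ j. \<integral>\<^sup>+ x. \<integral>\<^sup>+ y. indicator X (x + y) \<partial>?E j \<partial>?E i \<partial>B \<partial>A)"
    by (intro nn_integral_nat_pmf_swap) simp
  also have "\<dots> = (\<integral>\<^sup>+ i. \<integral>\<^sup>+ j. emeasure (convolution (?E i) (?E j)) X \<partial>B \<partial>A)"
    by (intro nn_integral_cong, subst convolution_emeasure') (simp_all add: E.finite_measure_axioms)
  also have "\<dots> = (\<integral>\<^sup>+ i. \<integral>\<^sup>+ j. emeasure (?E (Suc (i + j))) X \<partial>B \<partial>A)"
    by (simp add: convolution_erlang[OF l])
  also have "\<dots> = emeasure (erlang_mixture l (bind_pmf A (\<lambda>i. map_pmf (\<lambda>j. Suc (i + j)) B))) X"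
    by (simp add: emeasure_erlang_mixture[OF l X])
  finally show "emeasure (convolution (erlang_mixture l A) (erlang_mixture l B)) X
      = emeasure (erlang_mixture l (bind_pmf A (\<lambda>i. map_pmf (\<lambda>j. Suc (i + j)) B))) X" .
qed

text \<open>The law of the total number of stages of \<open>n + 1\<close> independent summands, less
  one; each summand has one stage more than a variable of law \<open>A\<close>.\<close>

primrec renewal_pmf :: "nat pmf \<Rightarrow> nat \<Rightarrow> nat pmf" where
  "renewal_pmf A 0 = A"
| "renewal_pmf A (Suc n) = bind_pmf A (\<lambda>i. map_pmf (\<lambda>j. Suc (i + j)) (renewal_pmf A n))"

lemma convolution_return_0:
  fixes M :: "real measure"
  assumes "finite_measure M" and S [measurable_cong]: "sets M = sets borel"
  shows "convolution M (return borel 0) = M"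
proof (rule measure_eqI)
  interpret r: prob_space "return borel (0::real)" by (rule prob_space_return) simp
  fix X assume "X \<in> sets (convolution M (return borel 0))"
  then have X: "X \<in> sets borel" by simp
  then show "emeasure (convolution M (return borel 0)) X = emeasure M X"
    using assms S
    by (subst convolution_emeasure')
       (simp_all add: r.finite_measure_axioms nn_integral_return)
qed (simp add: S)

text \<open>The zeroth power is the unit mass at 0, which is no Erlang mixture; hence the induction
  starts at the first power.\<close>

lemma conv_power_erlang_mixture:
  assumes "0 < l"
  shows "conv_power (erlang_mixture l A) (Suc n) = erlang_mixture l (renewal_pmf A n)"
proof (induction n)
  case 0
  interpret prob_space "erlang_mixture l A" by (rule prob_space_erlang_mixture[OF assms])
  show ?case using assms by (simp add: convolution_return_0 finite_measure_axioms)
next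
  case (Suc n)
  show ?case
    using convolution_erlang_mixture[OF assms, of A "renewal_pmf A n"] Suc by simp
qed


section \<open>Uniformisation of slower Erlang distributions\<close>

text \<open>In independent trials with success probability \<open>p\<close>, this is the law of the
  index of the trial with success number \<open>r + 1\<close>, less one: the failures counted by the
  negative binomial law plus the \<open>r\<close> earlier successes.\<close>

definition stage_pmf :: "nat \<Rightarrow> real \<Rightarrow> nat pmf" where
  "stage_pmf r p = map_pmf (\<lambda>k. k + r) (neg_binomial_pmf (Suc r) p)"

lemma pmf_stage_add:
  assumes "p \<in> {0<..1}"
  shows "pmf (stage_pmf r p) (k + r) = real ((k + r) choose r) * p ^ Suc r * (1 - p) ^ k"
proof -
  have "pmf (stage_pmf r p) (k + r) = pmf (neg_binomial_pmf (Suc r) p) k"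
    unfolding stage_pmf_def by (rule pmf_map_inj') (simp add: inj_def)
  then show ?thesis
    using assms binomial_symmetric[of k "k + r"] by (simp add: pmf_neg_binomial)
qed

lemma pmf_stage_less:
  assumes "i < r"
  shows "pmf (stage_pmf r p) i = 0"
  unfolding stage_pmf_def by (rule pmf_map_outside) (use assms in auto)

text \<open>The binomial coefficient cancels the factorial in \<open>erlang_density (k + r)\<close>.
  What remains is the exponential series in \<open>(1 - p) * l * x\<close>, whose sum changes the
  decay rate from \<open>l\<close> to \<open>p * l\<close>.\<close>

lemma erlang_density_stage_sums:
  assumes p: "p \<in> {0<..1}"
  shows "(\<lambda>k. pmf (neg_binomial_pmf (Suc r) p) k * erlang_density (k + r) l x) sums erlang_density r (p * l) x"
proof (cases "x < 0")
  case True
  then show ?thesis by (simp add: erlang_density_def)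
next
  case False
  define c where "c = (p * l) ^ Suc r * x ^ r * exp (- l * x) / fact r"
  have "pmf (neg_binomial_pmf (Suc r) p) k * erlang_density (k + r) l x
      = c * (((1 - p) * l * x) ^ k /\<^sub>R fact k)" for k
  proof -
    have *: "real ((k + r) choose k) / fact (k + r) = 1 / (fact k * fact r)"
      by (simp add: binomial_fact)
    have "pmf (neg_binomial_pmf (Suc r) p) k * erlang_density (k + r) l x
      = real ((k + r) choose k) / fact (k + r)
        * (p ^ Suc r * (1 - p) ^ k * l ^ Suc (k + r) * x ^ (k + r) * exp (- l * x))"
      using False p by (simp add: pmf_neg_binomial erlang_density_def)
    also have "\<dots> = c * (((1 - p) * l * x) ^ k /\<^sub>R fact k)"
      unfolding * by (simp add: c_def power_mult_distrib power_add divide_inverse ac_simps)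
    finally show ?thesis .
  qed
  moreover have "(\<lambda>k. c * (((1 - p) * l * x) ^ k /\<^sub>R fact k)) sums (c * exp ((1 - p) * l * x))"
    by (intro sums_mult exp_converges)
  moreover have "c * exp ((1 - p) * l * x) = erlang_density r (p * l) x"
  proof -
    have "exp (- l * x) * exp ((1 - p) * l * x) = exp (- (p * l) * x)"
      by (simp add: exp_add[symmetric] algebra_simps)
    then show ?thesis
      using False by (simp add: c_def erlang_density_def field_simps)
  qed
  ultimately show ?thesis by simp
qed

text \<open>Uniformisation: an exponential clock of rate \<^term>\<open>p * l\<close> is a clock of rate \<^term>\<open>l\<close> that is
  stopped at the first success of independent trials with success probability \<^term>\<open>p\<close>.\<close>

lemma erlang_mixture_stage_pmf:
  assumes p: "p \<in> {0<..1}" and l: "0 < l"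
  shows "erlang_mixture l (stage_pmf r p) = density lborel (erlang_density r (p * l))"
proof (rule measure_eqI)
  fix X assume "X \<in> sets (erlang_mixture l (stage_pmf r p))"
  then have X [measurable]: "X \<in> sets borel" using l by simp
  have nonneg: "0 \<le> pmf (neg_binomial_pmf (Suc r) p) k * erlang_density (k + r) l x" for k x
    using l by (simp add: less_imp_le)
  have suminf: "(\<Sum>k. ennreal (pmf (neg_binomial_pmf (Suc r) p) k) * erlang_density (k + r) l x)
      = erlang_density r (p * l) x" for x
    using suminf_ennreal_eq[OF nonneg erlang_density_stage_sums[OF p, of r l x]] l
    by (simp add: ennreal_mult less_imp_le)
  have "emeasure (erlang_mixture l (stage_pmf r p)) X
      = (\<Sum>k. ennreal (pmf (neg_binomial_pmf (Suc r) p) k)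
          * (\<integral>\<^sup>+ x. ennreal (erlang_density (k + r) l x) * indicator X x \<partial>lborel))"
    unfolding emeasure_erlang_mixture[OF l X] stage_pmf_def nn_integral_map_pmf
    by (simp add: nn_integral_nat_pmf emeasure_density)
  also have "\<dots> = (\<integral>\<^sup>+ x. (\<Sum>k. ennreal (pmf (neg_binomial_pmf (Suc r) p) k)
          * (ennreal (erlang_density (k + r) l x) * indicator X x)) \<partial>lborel)"
    by (simp add: nn_integral_suminf nn_integral_cmult)
  also have "\<dots> = (\<integral>\<^sup>+ x. ennreal (erlang_density r (p * l) x) * indicator X x \<partial>lborel)"
    by (simp add: mult.assoc[symmetric] suminf)
  also have "\<dots> = emeasure (density lborel (erlang_density r (p * l))) X"
    by (simp add: emeasure_density)
  finally show "emeasure (erlang_mixture l (stage_pmf r p)) X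
    = emeasure (density lborel (erlang_density r (p * l))) X" .
qed (use l in simp)

lemma erlang_mixture_bind_pmf:
  assumes l: "0 < l"
  shows "erlang_mixture l (bind_pmf P f) = measure_pmf P \<bind> (\<lambda>x. erlang_mixture l (f x))"
  unfolding erlang_mixture_def measure_pmf_bind
  using erlang_kernel_measurable[OF l] measurable_measure_pmf[of f]
  by (intro bind_assoc[where N="count_space UNIV" and R=borel]) simp_all

lemma cdf_erlang_mixture_bind_pmf:
  assumes l: "0 < l"
  shows "cdf (erlang_mixture l (bind_pmf P f)) u
    = measure_pmf.expectation P (\<lambda>x. cdf (erlang_mixture l (f x)) u)"
  unfolding erlang_mixture_bind_pmf[OF l] cdf_def
  by (rule measure_pmf.measure_bind[where N=borel])
     (use prob_space_erlang_mixture[OF l] l in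
       \<open>auto simp: space_subprob_algebra intro: prob_space_imp_subprob_space\<close>)

lemma real_distribution_erlang_mixture:
  assumes "0 < l"
  shows "real_distribution (erlang_mixture l A)"
  using prob_space_erlang_mixture[OF assms] assms
  by (simp add: real_distribution_def real_distribution_axioms_def)

text \<open>\<open>psi\<close> receives a distribution function and rebuilds its measure with
  \<open>interval_measure\<close>; this identity leads back to the mixture itself.\<close>

lemma (in real_distribution) interval_measure_cdf: "interval_measure (cdf M) = M"
proof (rule cdf_unique)
  show "real_distribution (interval_measure (cdf M))"
    by (rule real_distribution_interval_measure)
       (simp_all add: cdf_nondecreasing cdf_is_right_cont cdf_lim_at_bot cdf_lim_at_top_prob)
  show "cdf (interval_measure (cdf M)) = cdf M"
    by (rule cdf_interval_measure)
       (simp_all add: cdf_nondecreasing cdf_is_right_cont cdf_lim_at_bot)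
qed (rule real_distribution_axioms)

text \<open>Scaling by \<open>x\<close> turns the rate \<open>c\<close> into
  \<open>c / x = (a / x) * (c / a)\<close>. As \<open>a\<close> bounds the support from below,
  \<open>a / x\<close> is a success probability, and uniformisation brings all components to the
  single rate \<open>c / a\<close>.\<close>

lemma mellin_conv_Erlang:
  fixes P :: "real pmf"
  assumes c: "0 < c" and a: "0 < a" and P: "\<And>x. x \<in> set_pmf P \<Longrightarrow> a \<le> x"
  shows "mellin_conv (measure_pmf P) (Erlang (Suc r) c) u
    = cdf (erlang_mixture (c / a) (bind_pmf P (\<lambda>x. stage_pmf r (a / x)))) u"
proof -
  have l: "0 < c / a" using a c by simp
  have "cdf (erlang_mixture (c / a) (stage_pmf r (a / x))) u = indicator {0<..} x * Erlang (Suc r) c (u / x)"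
    if "x \<in> set_pmf P" for x
  proof -
    have x: "0 < x" "a / x \<in> {0<..1}" using P[OF that] a by auto
    have "cdf (erlang_mixture (c / a) (stage_pmf r (a / x))) u = erlang_CDF r (c / x) u"
      using x c a by (simp add: erlang_mixture_stage_pmf[OF x(2) l] cdf_erlang)
    \<comment> \<open>Both sides equal the distribution function of rate one at
      \<open>c * u / x\<close>.\<close>
    also have "\<dots> = erlang_CDF r c (u / x)"
      using x c erlang_CDF_transform[of "c / x" r u] erlang_CDF_transform[of c r "u / x"] by simp
    finally show ?thesis using x c by (simp add: Erlang_def cdf_erlang)
  qed
  then have "measure_pmf.expectation P (\<lambda>x. indicator {0<..} x * Erlang (Suc r) c (u / x))
      = measure_pmf.expectation P (\<lambda>x. cdf (erlang_mixture (c / a) (stage_pmf r (a / x))) u)"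
    by (intro integral_cong_AE) (auto simp: AE_measure_pmf_iff)
  then show ?thesis
    by (simp add: mellin_conv_def set_lebesgue_integral_def cdf_erlang_mixture_bind_pmf[OF l])
qed

section \<open>Binomial formulas for the stage law\<close>

lemma pmf_binomial_Suc_Suc:
  assumes "0 \<le> p" "p \<le> 1"
  shows "pmf (binomial_pmf (Suc n) p) (Suc k)
    = p * pmf (binomial_pmf n p) k + (1 - p) * pmf (binomial_pmf n p) (Suc k)"
proof (cases "k < n")
  case True
  then have "n - k = Suc (n - Suc k)" by simp
  then show ?thesis using assms by (simp add: field_simps)
qed (use assms in \<open>simp add: field_simps\<close>)

text \<open>One more trial destroys the event of at most \<open>r\<close> successes exactly when
  there were \<open>r\<close> successes before and the new trial succeeds.\<close>

lemma bin_cdf_Suc: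
  assumes "0 \<le> p" "p \<le> 1"
  shows "bin_cdf r (Suc n) p = bin_cdf r n p - p * bin_pmf r n p"
proof (induction r)
  case 0
  then show ?case using assms
    by (simp add: bin_cdf_def bin_pmf_def measure_measure_pmf_finite algebra_simps)
next
  case (Suc r)
  have step: "bin_cdf (Suc r) m p = bin_cdf r m p + bin_pmf (Suc r) m p" for m
    by (simp add: bin_cdf_def bin_pmf_def measure_measure_pmf_finite)
  show ?case
    using Suc pmf_binomial_Suc_Suc[OF assms, of n r] unfolding step
    by (simp add: bin_pmf_def algebra_simps)
qed

text \<open>Trial \<open>i + 1\<close> brings success number \<open>r + 1\<close> when the first
  \<open>i\<close> trials contain exactly \<open>r\<close> successes and the next one
  succeeds.\<close>

lemma pmf_stage:
  assumes p: "p \<in> {0<..1}"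
  shows "pmf (stage_pmf r p) i = p * bin_pmf r i p"
proof (cases "i < r")
  case True
  then show ?thesis using p by (simp add: pmf_stage_less bin_pmf_def)
next
  case False
  then show ?thesis
    using p pmf_stage_add[OF p, of r "i - r"] by (simp add: bin_pmf_def)
qed

text \<open>The absorption identity for binomial coefficients gives the mass in the form that
  \<open>B_trunc\<close> uses.\<close>

lemma pmf_stage':
  assumes p: "p \<in> {0<..1}"
  shows "pmf (stage_pmf r p) i = real (Suc r) / real (i + 1) * bin_pmf (Suc r) (i + 1) p"
proof -
  have "real (Suc r) * real (Suc i choose Suc r) = real (Suc i) * real (i choose r)"
    using binomial_absorption[of r "Suc i"] by (metis diff_Suc_1 of_nat_mult)
  then have "real (Suc r) / real (i + 1) * real (Suc i choose Suc r) = real (i choose r)"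
    by (simp add: field_simps)
  then show ?thesis
    using p by (simp add: pmf_stage bin_pmf_def mult.assoc[symmetric] del: binomial_Suc_Suc of_nat_Suc)
qed

text \<open>At most \<open>r\<close> successes in \<open>n\<close> trials means that success number
  \<open>r + 1\<close> comes later, so the binomial distribution function is the tail of the stage
  law at \<open>n\<close>.\<close>

lemma bin_cdf_stage:
  assumes p: "p \<in> {0<..1}"
  shows "bin_cdf r n p = 1 - (\<Sum>i<n. pmf (stage_pmf r p) i)"
proof (induction n)
  case 0
  then show ?case using p by (simp add: bin_cdf_def binomial_pmf_0)
next
  case (Suc n)
  then show ?case using p by (simp add: bin_cdf_Suc pmf_stage[OF p])
qed


section \<open>Tails of geometric compounds and their renewal equation\<close>

lemma prob_atLeast:
  "measure_pmf.prob A {k..} = 1 - (\<Sum>i<k. pmf A i)" for A :: "nat pmf"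
proof -
  have "{k..} = - {..<k}" by auto
  then show ?thesis
    using measure_pmf.prob_compl[of "{..<k}" A] by (simp add: Compl_eq_Diff_UNIV measure_measure_pmf_finite)
qed

text \<open>Condition on the first summand \<open>i\<close>. Either it reaches \<open>k\<close>
  alone, or \<open>i < k\<close> and \<open>Suc (i + j)\<close> reaches \<open>k\<close> exactly
  when \<open>j\<close> is at least \<open>k - 1 - i\<close>.\<close>

lemma prob_renewal_pmf_Suc:
  "measure_pmf.prob (renewal_pmf A (Suc n)) {k..}
    = measure_pmf.prob A {k..} + (\<Sum>i<k. pmf A i * measure_pmf.prob (renewal_pmf A n) {k - 1 - i..})"
proof -
  let ?B = "renewal_pmf A n"
  have "measure_pmf.prob (renewal_pmf A (Suc n)) {k..}
      = measure_pmf.expectation A (\<lambda>i. measure_pmf.prob (map_pmf (\<lambda>j. Suc (i + j)) ?B) {k..})"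
    unfolding renewal_pmf.simps measure_pmf_bind
    by (rule measure_pmf.measure_bind[where N="count_space UNIV"])
       (auto intro: measurable_measure_pmf[THEN measurable_space])
  also have "\<dots> = measure_pmf.expectation A (\<lambda>i. indicator {k..} i
      + (if i < k then measure_pmf.prob ?B {k - 1 - i..} else 0))"
  proof (intro Bochner_Integration.integral_cong refl)
    fix i
    show "measure_pmf.prob (map_pmf (\<lambda>j. Suc (i + j)) ?B) {k..} = indicator {k..} i
      + (if i < k then measure_pmf.prob ?B {k - 1 - i..} else 0)"
    proof (cases "i < k")
      case True
      then have "(\<lambda>j. Suc (i + j)) -` {k..} = {k - 1 - i..}" by auto
      with True show ?thesis by (simp add: measure_map_pmf)
    next
      case False
      then have "(\<lambda>j. Suc (i + j)) -` {k..} = UNIV" by auto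
      with False show ?thesis by (simp add: measure_map_pmf)
    qed
  qed
  also have "\<dots> = measure_pmf.prob A {k..}
      + measure_pmf.expectation A (\<lambda>i. if i < k then measure_pmf.prob ?B {k - 1 - i..} else 0)"
    by (subst Bochner_Integration.integral_add)
       (auto intro!: measure_pmf.integrable_const_bound[where B=1])
  also have "measure_pmf.expectation A (\<lambda>i. if i < k then measure_pmf.prob ?B {k - 1 - i..} else 0)
      = (\<Sum>i<k. pmf A i * measure_pmf.prob ?B {k - 1 - i..})"
    by (subst integral_measure_pmf_real[where A="{..<k}"])
       (auto simp: mult.commute intro!: sum.cong split: if_splits)
  finally show ?thesis .
qed

text \<open>The probability that a geometric number of summands has more than \<open>k\<close>
  stages in total. The exponent is \<open>Suc n\<close> because \<open>renewal_pmf A n\<close> has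
  \<open>n + 1\<close> summands; the empty sum never exceeds \<open>k\<close>. These are the exact
  coefficients \<kappa> of the Poisson expansion.\<close>

definition compound_tail :: "real \<Rightarrow> nat pmf \<Rightarrow> nat \<Rightarrow> real" where
  "compound_tail \<rho> A k = (1 - \<rho>) * (\<Sum>n. \<rho> ^ Suc n * measure_pmf.prob (renewal_pmf A n) {k..})"

lemma summable_power_mult_bounded:
  fixes \<rho> :: real
  assumes "0 \<le> \<rho>" "\<rho> < 1" "\<And>n. 0 \<le> f n" "\<And>n. f n \<le> C"
  shows "summable (\<lambda>n. \<rho> ^ Suc n * f n)"
proof (rule summable_comparison_test')
  show "summable (\<lambda>n. \<rho> ^ Suc n * C)"
    using assms by (intro summable_mult2) (simp add: summable_mult summable_geometric)
  show "norm (\<rho> ^ Suc n * f n) \<le> \<rho> ^ Suc n * C" for n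
    using assms by (simp add: abs_mult mult_left_mono del: power_Suc)
qed

lemma suminf_power_Suc:
  fixes \<rho> :: real
  assumes "0 \<le> \<rho>" "\<rho> < 1"
  shows "(1 - \<rho>) * (\<Sum>n. \<rho> ^ Suc n * C) = \<rho> * C"
proof -
  have "(\<lambda>n. \<rho> * C * \<rho> ^ n) sums (\<rho> * C * (1 / (1 - \<rho>)))"
    using assms by (intro sums_mult geometric_sums) simp
  then have "(\<Sum>n. \<rho> ^ Suc n * C) = \<rho> * C / (1 - \<rho>)"
    by (simp add: sums_iff ac_simps)
  then show ?thesis using assms by simp
qed

lemma compound_tail_le:
  assumes "0 \<le> \<rho>" "\<rho> < 1"
  shows "compound_tail \<rho> A k \<le> \<rho>"
proof -
  have "compound_tail \<rho> A k \<le> (1 - \<rho>) * (\<Sum>n. \<rho> ^ Suc n * 1)"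
    unfolding compound_tail_def using assms
    by (intro mult_left_mono suminf_le summable_power_mult_bounded[where C=1]) auto
  then show ?thesis using suminf_power_Suc[OF assms, of 1] by simp
qed

lemma compound_tail_renewal:
  assumes \<rho>: "0 \<le> \<rho>" "\<rho> < 1"
  shows "compound_tail \<rho> A k
    = \<rho> * (measure_pmf.prob A {k..} + (\<Sum>i<k. pmf A i * compound_tail \<rho> A (k - 1 - i)))"
proof -
  let ?t = "\<lambda>n k. measure_pmf.prob (renewal_pmf A n) {k..}"
  let ?a = "measure_pmf.prob A {k..}"
  have s: "summable (\<lambda>n. \<rho> ^ Suc n * ?t n k)" for k
    using \<rho> by (intro summable_power_mult_bounded[where C=1]) auto
  have s1: "summable (\<lambda>n. \<rho> ^ Suc n * ?a)"
    using \<rho> by (intro summable_power_mult_bounded[where C=1]) auto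
  have "(\<Sum>n. \<rho> ^ Suc n * ?t n k) = \<rho> * ?a + (\<Sum>n. \<rho> ^ Suc (Suc n) * ?t (Suc n) k)"
    using suminf_split_head[OF s[of k]] by simp
  also have "(\<Sum>n. \<rho> ^ Suc (Suc n) * ?t (Suc n) k)
      = (\<Sum>n. \<rho> * (\<rho> ^ Suc n * ?a) + (\<Sum>i<k. \<rho> * pmf A i * (\<rho> ^ Suc n * ?t n (k - 1 - i))))"
    by (simp only: prob_renewal_pmf_Suc) (simp add: distrib_left sum_distrib_left ac_simps)
  also have "\<dots> = (\<Sum>n. \<rho> * (\<rho> ^ Suc n * ?a))
      + (\<Sum>n. \<Sum>i<k. \<rho> * pmf A i * (\<rho> ^ Suc n * ?t n (k - 1 - i)))"
    by (intro suminf_add[symmetric] summable_sum summable_mult s s1)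
  also have "\<dots> = \<rho> * (\<Sum>n. \<rho> ^ Suc n * ?a)
      + (\<Sum>i<k. \<rho> * pmf A i * (\<Sum>n. \<rho> ^ Suc n * ?t n (k - 1 - i)))"
    using s s1 by (simp only: suminf_sum summable_mult suminf_mult)
  \<comment> \<open>A single summand contributes \<open>(1 - \<rho>) * \<rho> * ?a\<close>, and the
    event that the first of several summands reaches \<open>k\<close> contributes
    \<open>\<rho> * (\<rho> * ?a)\<close>; together they give \<open>\<rho> * ?a\<close>.\<close>
  finally have "compound_tail \<rho> A k = (1 - \<rho>) * \<rho> * ?a + \<rho> * ((1 - \<rho>) * (\<Sum>n. \<rho> ^ Suc n * ?a))
      + (\<Sum>i<k. \<rho> * pmf A i * compound_tail \<rho> A (k - 1 - i))"
    by (simp add: compound_tail_def distrib_left sum_distrib_left ac_simps del: power_Suc)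
  then show ?thesis
    unfolding suminf_power_Suc[OF \<rho>] by (simp add: sum_distrib_left algebra_simps)
qed

section \<open>Poisson expansion cut at a finite level\<close>

text \<open>The difference \<open>1 - poisson_cdf N x\<close> is the Erlang distribution function of
  shape \<open>N + 1\<close> and rate one, hence nonnegative.\<close>

lemma poisson_cdf_le_1:
  assumes "0 \<le> x"
  shows "poisson_cdf N x \<le> 1"
  using erlang_CDF_nonneg[of 1 N x] assms by (simp add: erlang_CDF_def poisson_cdf_def ac_simps)

text \<open>The Erlang tail with index \<open>i\<close> is the Poisson distribution function at
  \<open>i\<close>. For \<open>i \<le> N\<close> the sum over \<open>k\<close> reproduces it;
  otherwise the sum is \<open>poisson_cdf N (l * u)\<close>, and adding the remaining Poisson mass
  gives 1.\<close>

lemma erlang_CDF_ge_truncated: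
  assumes "0 < l" "0 \<le> u"
  shows "1 - erlang_CDF i l u
    \<le> (\<Sum>k\<le>N. (l * u) ^ k / fact k * exp (- (l * u)) * indicator {k..} i) + (1 - poisson_cdf N (l * u))"
proof -
  let ?q = "\<lambda>k. (l * u) ^ k / fact k * exp (- (l * u))"
  have x: "0 \<le> l * u" using assms by simp
  have E: "1 - erlang_CDF i l u = poisson_cdf i (l * u)"
    using assms by (simp add: erlang_CDF_def poisson_cdf_def ac_simps)
  show ?thesis
  proof (cases "i \<le> N")
    case True
    have "poisson_cdf i (l * u) = (\<Sum>k\<le>N. ?q k * indicator {k..} i)"
      unfolding poisson_cdf_def using True
      by (intro sum.mono_neutral_cong_left) (auto simp: indicator_def)
    then show ?thesis unfolding E using poisson_cdf_le_1[OF x, of N] by simp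
  next
    case False
    then have "poisson_cdf N (l * u) = (\<Sum>k\<le>N. ?q k * indicator {k..} i)"
      unfolding poisson_cdf_def by (intro sum.cong) (auto simp: indicator_def)
    then show ?thesis unfolding E using poisson_cdf_le_1[OF x, of i] by simp
  qed
qed

lemma erlang_mixture_tail_le:
  assumes l: "0 < l" and u: "0 \<le> u"
  shows "1 - cdf (erlang_mixture l A) u
    \<le> (\<Sum>k\<le>N. (l * u) ^ k / fact k * exp (- (l * u)) * measure_pmf.prob A {k..}) + (1 - poisson_cdf N (l * u))"
proof -
  let ?q = "\<lambda>k. (l * u) ^ k / fact k * exp (- (l * u))"
  have "0 \<le> erlang_CDF i l u" "erlang_CDF i l u \<le> 1" for i
    using l u erlang_CDF_nonneg[OF l, of i u] by (simp_all add: erlang_CDF_def sum_nonneg)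
  then have int: "integrable (measure_pmf A) (\<lambda>i. erlang_CDF i l u)"
    by (intro measure_pmf.integrable_const_bound[where B=1]) auto
  have intq: "integrable (measure_pmf A) (\<lambda>i. ?q k * indicator {k..} i)" for k
    by (intro Bochner_Integration.integrable_mult_right measure_pmf.integrable_const_bound[where B=1]) auto
  have "1 - cdf (erlang_mixture l A) u = measure_pmf.expectation A (\<lambda>i. 1 - erlang_CDF i l u)"
    using int by (simp add: cdf_erlang_mixture[OF l])
  also have "\<dots> \<le> measure_pmf.expectation A (\<lambda>i. (\<Sum>k\<le>N. ?q k * indicator {k..} i)
      + (1 - poisson_cdf N (l * u)))"
  proof (rule integral_mono)
    show "integrable (measure_pmf A) (\<lambda>i. (\<Sum>k\<le>N. ?q k * indicator {k..} i)
      + (1 - poisson_cdf N (l * u)))"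
      by (intro Bochner_Integration.integrable_add Bochner_Integration.integrable_sum intq) simp
  qed (use int erlang_CDF_ge_truncated[OF l u] in simp_all)
  also have "\<dots> = (\<Sum>k\<le>N. ?q k * measure_pmf.prob A {k..}) + (1 - poisson_cdf N (l * u))"
    by (simp only: Bochner_Integration.integral_add[OF Bochner_Integration.integrable_sum[OF intq]
          measure_pmf.integrable_const] Bochner_Integration.integral_sum[OF intq]) simp
  finally show ?thesis .
qed

text \<open>Only an upper bound is sought, so each convolution power is cut at \<open>N\<close>
  before summing over \<open>n\<close>. The weights \<open>(1 - \<rho>) * \<rho> ^ Suc n\<close> add
  up to \<rho>, the factor of the leftover Poisson mass.\<close>

lemma psi_erlang_mixture_le:
  assumes H: "interval_measure H = erlang_mixture l A"
    and l: "0 < l" and u: "0 \<le> u" and \<rho>: "0 \<le> \<rho>" "\<rho> < 1"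
  shows "psi \<rho> H u \<le> (\<Sum>k\<le>N. (l * u) ^ k / fact k * exp (- (l * u)) * compound_tail \<rho> A k)
    + \<rho> * (1 - poisson_cdf N (l * u))"
proof -
  let ?q = "\<lambda>k. (l * u) ^ k / fact k * exp (- (l * u))"
  let ?t = "\<lambda>n k. measure_pmf.prob (renewal_pmf A n) {k..}"
  let ?z = "1 - poisson_cdf N (l * u)"
  have s: "summable (\<lambda>n. \<rho> ^ Suc n * ?t n k)" for k
    using \<rho> by (intro summable_power_mult_bounded[where C=1]) auto
  have sz: "summable (\<lambda>n. \<rho> ^ Suc n * ?z)"
    using \<rho> poisson_cdf_le_1[of "l * u" N] l u by (intro summable_power_mult_bounded[where C="?z"]) auto
  have sq: "summable (\<lambda>n. \<Sum>k\<le>N. ?q k * (\<rho> ^ Suc n * ?t n k))"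
    by (intro summable_sum summable_mult s)
  have tail: "\<rho> ^ Suc n * (1 - cdf (erlang_mixture l (renewal_pmf A n)) u)
      \<le> (\<Sum>k\<le>N. ?q k * (\<rho> ^ Suc n * ?t n k)) + \<rho> ^ Suc n * ?z" for n
  proof -
    have "\<rho> ^ Suc n * (1 - cdf (erlang_mixture l (renewal_pmf A n)) u)
        \<le> \<rho> ^ Suc n * ((\<Sum>k\<le>N. ?q k * ?t n k) + ?z)"
      using \<rho> by (intro mult_left_mono erlang_mixture_tail_le[OF l u]) simp
    also have "\<dots> = (\<Sum>k\<le>N. ?q k * (\<rho> ^ Suc n * ?t n k)) + \<rho> ^ Suc n * ?z"
      by (simp only: distrib_left sum_distrib_left) (simp only: ac_simps)
    finally show ?thesis .
  qed
  have cdf01: "0 \<le> 1 - cdf (erlang_mixture l B) u" "1 - cdf (erlang_mixture l B) u \<le> 1" for B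
  proof -
    interpret prob_space "erlang_mixture l B" by (rule prob_space_erlang_mixture[OF l])
    show "0 \<le> 1 - cdf (erlang_mixture l B) u" "1 - cdf (erlang_mixture l B) u \<le> 1"
      by (simp_all add: cdf_def)
  qed
  have "psi \<rho> H u = (1 - \<rho>) * (\<Sum>n. \<rho> ^ Suc n * (1 - cdf (erlang_mixture l (renewal_pmf A n)) u))"
    unfolding psi_def H conv_power_erlang_mixture[OF l] ..
  also have "\<dots> \<le> (1 - \<rho>) * (\<Sum>n. (\<Sum>k\<le>N. ?q k * (\<rho> ^ Suc n * ?t n k)) + \<rho> ^ Suc n * ?z)"
  proof (intro mult_left_mono suminf_le tail)
    show "summable (\<lambda>n. \<rho> ^ Suc n * (1 - cdf (erlang_mixture l (renewal_pmf A n)) u))"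
      using \<rho> cdf01 by (intro summable_power_mult_bounded[where C=1])
    show "summable (\<lambda>n. (\<Sum>k\<le>N. ?q k * (\<rho> ^ Suc n * ?t n k)) + \<rho> ^ Suc n * ?z)"
      by (intro summable_add sq sz)
  qed (use \<rho> in simp)
  also have "(\<Sum>n. (\<Sum>k\<le>N. ?q k * (\<rho> ^ Suc n * ?t n k)) + \<rho> ^ Suc n * ?z)
      = (\<Sum>n. \<Sum>k\<le>N. ?q k * (\<rho> ^ Suc n * ?t n k)) + (\<Sum>n. \<rho> ^ Suc n * ?z)"
    by (rule suminf_add[OF sq sz, symmetric])
  also have "(\<Sum>n. \<Sum>k\<le>N. ?q k * (\<rho> ^ Suc n * ?t n k)) = (\<Sum>k\<le>N. \<Sum>n. ?q k * (\<rho> ^ Suc n * ?t n k))"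
    by (rule suminf_sum) (intro summable_mult s)
  also have "\<dots> = (\<Sum>k\<le>N. ?q k * (\<Sum>n. \<rho> ^ Suc n * ?t n k))"
    by (intro sum.cong refl suminf_mult s)
  finally show ?thesis
    unfolding distrib_left suminf_power_Suc[OF \<rho>]
    by (simp add: compound_tail_def sum_distrib_left ac_simps del: power_Suc)
qed


section \<open>Truncated coefficients compared with the exact ones\<close>

lemma B_trunc_stage:
  assumes "\<And>j. 1 \<le> j \<Longrightarrow> s 1 / s j \<in> {0<..1}"
  shows "B_trunc P s (Suc r) N i = (\<Sum>j = 1..N. pmf P (s j) * pmf (stage_pmf r (s 1 / s j)) i)"
  unfolding B_trunc_def sum_distrib_left
  using assms by (intro sum.cong refl) (simp add: pmf_stage' del: of_nat_Suc)

text \<open>By \<open>bin_cdf_stage\<close> this is the tail at \<open>n\<close> of the part of the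
  stage mixture that comes from the kept atoms.\<close>

lemma C_trunc_stage:
  assumes "\<And>j. 1 \<le> j \<Longrightarrow> s 1 / s j \<in> {0<..1}"
  shows "C_trunc P s (Suc r) N n = (\<Sum>j = 1..N. pmf P (s j)) - (\<Sum>i<n. B_trunc P s (Suc r) N i)"
proof -
  have "C_trunc P s (Suc r) N n
      = (\<Sum>j = 1..N. pmf P (s j) - (\<Sum>i<n. pmf P (s j) * pmf (stage_pmf r (s 1 / s j)) i))"
    unfolding C_trunc_def using assms
    by (intro sum.cong refl) (simp add: bin_cdf_stage algebra_simps sum_distrib_left)
  then show ?thesis
    by (simp add: sum_subtractf B_trunc_stage[where s=s, OF assms] sum.swap[of _ "{..<n}"])
qed

lemma B_trunc_nonneg: "0 \<le> B_trunc P s \<xi> N i"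
  unfolding B_trunc_def bin_pmf_def by (intro mult_nonneg_nonneg sum_nonneg) simp_all

text \<open>Lets the sum in \<open>kappa_trunc\<close>, which starts at \<open>\<xi> - 1\<close>,
  run over all \<open>i < n\<close> as in the renewal equation.\<close>

lemma B_trunc_less:
  assumes "\<And>j. 1 \<le> j \<Longrightarrow> s 1 / s j \<in> {0<..1}" "i < r"
  shows "B_trunc P s (Suc r) N i = 0"
  using assms(2) by (simp add: B_trunc_stage[where s=s, OF assms(1)] pmf_stage_less)

text \<open>The kept atoms contribute a partial sum of nonnegative terms; injectivity of
  \<open>s\<close> ensures that no atom is counted twice.\<close>

lemma B_trunc_le_pmf:
  assumes p: "\<And>j. 1 \<le> j \<Longrightarrow> s 1 / s j \<in> {0<..1}" and inj: "inj_on s {1..}"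
  shows "B_trunc P s (Suc r) N i \<le> pmf (bind_pmf P (\<lambda>x. stage_pmf r (s 1 / x))) i"
proof -
  let ?f = "\<lambda>x. pmf (stage_pmf r (s 1 / x)) i"
  have "B_trunc P s (Suc r) N i = (\<Sum>x\<in>s ` {1..N}. pmf P x * ?f x)"
    using inj by (simp add: B_trunc_stage[where s=s, OF p] sum.reindex inj_on_subset[OF inj])
  also have "\<dots> = measure_pmf.expectation P (\<lambda>x. indicator (s ` {1..N}) x * ?f x)"
    by (subst integral_measure_pmf_real[where A="s ` {1..N}"])
       (auto simp: indicator_def mult.commute intro!: sum.cong)
  also have "\<dots> \<le> measure_pmf.expectation P ?f"
    by (intro integral_mono measure_pmf.integrable_const_bound[where B=1])
       (auto simp: indicator_def pmf_le_1)
  finally show ?thesis by (simp add: pmf_bind)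
qed

text \<open>The bound is the mean \<^term>\<open>\<rho> / (1 - \<rho>)\<close> of the geometric number of summands times the probability
  \<^term>\<open>\<epsilon>\<close> that the truncation loses a given summand.\<close>

lemma compound_tail_minus_kappa_trunc_le:
  assumes \<rho>: "0 \<le> \<rho>" "\<rho> < 1"
    and p: "\<And>j. 1 \<le> j \<Longrightarrow> s 1 / s j \<in> {0<..1}" and inj: "inj_on s {1..}"
    and eps: "(\<Sum>j = 1..N. pmf P (s j)) = 1 - \<epsilon>" "0 \<le> \<epsilon>"
  shows "compound_tail \<rho> (bind_pmf P (\<lambda>x. stage_pmf r (s 1 / x))) n - kappa_trunc \<rho> P s (Suc r) N n
    \<le> \<epsilon> * (\<rho> / (1 - \<rho>))"
proof (induction n rule: less_induct)
  case (less n)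
  define A where "A = bind_pmf P (\<lambda>x. stage_pmf r (s 1 / x))"
  let ?b = "B_trunc P s (Suc r) N" and ?\<kappa> = "compound_tail \<rho> A"
    and ?\<kappa>' = "kappa_trunc \<rho> P s (Suc r) N" and ?D = "\<epsilon> * (\<rho> / (1 - \<rho>))"
  have D: "0 \<le> ?D" using \<rho> eps by simp
  have b: "0 \<le> ?b i" "?b i \<le> pmf A i" for i
    using B_trunc_nonneg B_trunc_le_pmf[where s=s, OF p inj] by (auto simp: A_def)
  show ?case
  proof (cases "n < Suc r")
    case True
    then show ?thesis
      using compound_tail_le[OF \<rho>, of A n] D by (simp add: kappa_trunc.simps A_def)
  next
    case False
    have "(\<Sum>i\<in>{r..<n}. ?\<kappa>' (n - 1 - i) * ?b i) = (\<Sum>i<n. ?\<kappa>' (n - 1 - i) * ?b i)"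
      by (rule sum.mono_neutral_left) (auto simp: B_trunc_less[where s=s, OF p])
    then have \<kappa>': "?\<kappa>' n = \<rho> * ((\<Sum>i<n. ?\<kappa>' (n - 1 - i) * ?b i) + (1 - \<epsilon> - (\<Sum>i<n. ?b i)))"
      using False by (subst kappa_trunc.simps) (simp add: C_trunc_stage[where s=s, OF p] eps[simplified])
    have \<kappa>: "?\<kappa> n = \<rho> * (1 - (\<Sum>i<n. pmf A i) + (\<Sum>i<n. pmf A i * ?\<kappa> (n - 1 - i)))"
      using compound_tail_renewal[OF \<rho>, of A n] by (simp add: prob_atLeast)
    have term_le: "?b i - pmf A i + pmf A i * ?\<kappa> (n - 1 - i) - ?\<kappa>' (n - 1 - i) * ?b i \<le> ?b i * ?D"
      if "i < n" for i
    proof -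
      have "0 \<le> (pmf A i - ?b i) * (1 - ?\<kappa> (n - 1 - i))"
        using b[of i] compound_tail_le[OF \<rho>, of A "n - 1 - i"] \<rho> by (intro mult_nonneg_nonneg) simp_all
      moreover have "?b i * (?\<kappa> (n - 1 - i) - ?\<kappa>' (n - 1 - i)) \<le> ?b i * ?D"
        using less.IH[of "n - 1 - i"] that b[of i] by (intro mult_left_mono) (simp_all add: A_def)
      ultimately show ?thesis by (simp add: algebra_simps)
    qed
    have "(\<Sum>i<n. ?b i) \<le> (\<Sum>i<n. pmf A i)"
      by (intro sum_mono b)
    also have "\<dots> \<le> 1"
      using prob_atLeast[of A n] measure_nonneg[of A "{n..}"] by linarith
    finally have b1: "(\<Sum>i<n. ?b i) \<le> 1" .
    \<comment> \<open>The isolated \<epsilon> is the difference of the total masses 1 and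
      \<open>1 - \<epsilon>\<close>.\<close>
    have "?\<kappa> n - ?\<kappa>' n = \<rho> * (\<epsilon> + (\<Sum>i<n. ?b i - pmf A i + pmf A i * ?\<kappa> (n - 1 - i) - ?\<kappa>' (n - 1 - i) * ?b i))"
      unfolding \<kappa> \<kappa>' by (simp only: sum.distrib sum_subtractf) (simp only: algebra_simps)
    also have "\<dots> \<le> \<rho> * (\<epsilon> + (\<Sum>i<n. ?b i * ?D))"
      using \<rho> term_le by (intro mult_left_mono add_left_mono sum_mono) simp_all
    also have "\<dots> = \<rho> * (\<epsilon> + (\<Sum>i<n. ?b i) * ?D)"
      by (simp only: sum_distrib_right)
    also have "\<dots> \<le> \<rho> * (\<epsilon> + 1 * ?D)"
      using \<rho> D b1 by (intro mult_left_mono add_left_mono mult_right_mono)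
    \<comment> \<open>The bound is chosen as the fixed point of
      \<open>D = \<rho> * (\<epsilon> + D)\<close>, so the induction closes without loss.\<close>
    also have "\<dots> = ?D"
      using \<rho> by (simp add: field_simps)
    finally show ?thesis by (simp add: A_def)
  qed
qed

section \<open>Passage to the stated bound\<close>

text \<open>For \<open>1 \<le> x\<close> the linear term suffices. Below 1, the chain \<open>1 - x
  \<le> 1 - (1 - \<rho>) * x \<le> exp (- ((1 - \<rho>) * x))\<close> is combined with the
  comparison of coefficients from \<open>\<rho> * (1 - \<rho>) \<le> 1\<close>.\<close>

lemma geometric_mean_le_linear_plus_exp:
  fixes \<rho> x :: real
  assumes \<rho>: "0 \<le> \<rho>" "\<rho> < 1" and x: "0 \<le> x"
  shows "\<rho> / (1 - \<rho>) \<le> \<rho> / (1 - \<rho>) * x + 2 / (1 - \<rho>)\<^sup>2 * exp (- ((1 - \<rho>) * x))"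
proof (cases "1 \<le> x")
  case True
  have "\<rho> / (1 - \<rho>) * 1 \<le> \<rho> / (1 - \<rho>) * x"
    using True \<rho> by (intro mult_left_mono) simp_all
  then show ?thesis by (smt (verit) zero_le_divide_iff zero_le_power2 exp_ge_zero mult_nonneg_nonneg)
next
  case False
  have "\<rho> / (1 - \<rho>) \<le> 1 / (1 - \<rho>)\<^sup>2"
  proof -
    have "\<rho> * (1 - \<rho>) \<le> 1 * 1" using \<rho> by (intro mult_mono) simp_all
    then show ?thesis using \<rho> by (simp add: divide_simps power2_eq_square mult.assoc[symmetric])
  qed
  also have "\<dots> \<le> 2 / (1 - \<rho>)\<^sup>2"
    by (simp add: divide_right_mono)
  finally have coeff: "\<rho> / (1 - \<rho>) \<le> 2 / (1 - \<rho>)\<^sup>2" .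
  have "(1 - \<rho>) * x \<le> 1 * x" using \<rho> x by (intro mult_right_mono) simp_all
  then have "1 - x \<le> exp (- ((1 - \<rho>) * x))"
    using exp_ge_add_one_self[of "- ((1 - \<rho>) * x)"] by simp
  then have "\<rho> / (1 - \<rho>) * (1 - x) \<le> 2 / (1 - \<rho>)\<^sup>2 * exp (- ((1 - \<rho>) * x))"
    using coeff False by (intro mult_mono) simp_all
  then show ?thesis unfolding right_diff_distrib by linarith
qed

theorem theorem5p2:
  fixes P :: "real pmf" and s :: "nat \<Rightarrow> real"
    and \<xi> N1 N2 :: nat and \<gamma> \<mu>F \<epsilon>1 u :: real
  assumes s_pos: "0 < s 1"
    and s_increasing: "strict_mono_on {1..} s"
    and support: "set_pmf P = s ` {1..}"
    and shape: "\<xi> \<ge> 1"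
    and gamma_pos: "\<gamma> > 0"
    and mu_pos: "\<mu>F > 0"
    and rho_less_1: "\<gamma> * \<mu>F < 1"
    and N2_pos: "N2 \<ge> 1"
    and eps: "\<epsilon>1 = measure_pmf.prob P {x. x > s N2}"
    and u_nonneg: "u \<ge> 0"
  shows "psi (\<gamma> * \<mu>F) (mellin_conv (measure_pmf P) (Erlang \<xi> (real \<xi>))) u
           - psi_trunc (\<gamma> * \<mu>F) P s \<xi> N1 N2 u
         \<le> \<epsilon>1 * (\<gamma> * \<mu>F / (1 - \<gamma> * \<mu>F) * (real \<xi> * u / s 1)
                 + 2 / (1 - \<gamma> * \<mu>F)\<^sup>2 * exp (- ((1 - \<gamma> * \<mu>F) * (real \<xi> * u) / s 1)))
           + (1 - poisson_cdf N1 (real \<xi> * u / s 1))"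
proof -
  obtain r where \<xi>: "\<xi> = Suc r" using shape by (cases \<xi>) auto
  define \<rho> where "\<rho> = \<gamma> * \<mu>F"
  define l where "l = real \<xi> / s 1"
  define A where "A = bind_pmf P (\<lambda>x. stage_pmf r (s 1 / x))"
  define q where "q = (\<lambda>k. (l * u) ^ k / fact k * exp (- (l * u)))"
  define \<zeta> where "\<zeta> = poisson_cdf N1 (l * u)"
  have \<rho>: "0 \<le> \<rho>" "\<rho> < 1" using gamma_pos mu_pos rho_less_1 by (simp_all add: \<rho>_def)
  have l: "0 < l" using s_pos \<xi> by (simp add: l_def)
  have lu: "0 \<le> l * u" "l * u = real \<xi> * u / s 1" using l u_nonneg by simp (simp add: l_def)
  have mono: "s 1 \<le> s j" if "1 \<le> j" for j
    using s_increasing that by (cases "j = 1") (auto simp: strict_mono_on_def intro!: less_imp_le)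
  have p: "s 1 / s j \<in> {0<..1}" if "1 \<le> j" for j
    using mono[OF that] s_pos by auto
  have inj: "inj_on s {1..}" using s_increasing by (rule strict_mono_on_imp_inj_on)
  have eps0: "0 \<le> \<epsilon>1" by (simp add: eps)
  have mass: "(\<Sum>j = 1..N2. pmf P (s j)) = 1 - \<epsilon>1"
  proof -
    \<comment> \<open>Since \<open>s\<close> increases strictly, the atoms not above
      \<open>s N2\<close> are exactly those with index at most \<open>N2\<close>; the kept mass is
      therefore the complement of \<open>\<epsilon>1\<close>.\<close>
    have "x \<in> s ` {1..N2} \<longleftrightarrow> x \<notin> {x. x > s N2}" if x: "x \<in> set_pmf P" for x
    proof -
      obtain j where j: "1 \<le> j" "x = s j" using x support by auto
      have "s j \<le> s N2 \<longleftrightarrow> j \<le> N2"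
        using strict_mono_on_less_eq[OF s_increasing, of j N2] j N2_pos by simp
      moreover have "s j \<in> s ` {1..N2} \<longleftrightarrow> j \<le> N2"
        using inj_on_image_mem_iff[OF inj, of j "{1..N2}"] j by auto
      ultimately show ?thesis using j by auto
    qed
    then have "measure_pmf.prob P (s ` {1..N2}) = measure_pmf.prob P (UNIV - {x. x > s N2})"
      by (intro measure_pmf.finite_measure_eq_AE) (auto simp: AE_measure_pmf_iff)
    also have "\<dots> = 1 - \<epsilon>1"
      using measure_pmf.prob_compl[of "{x. x > s N2}" P] by (simp add: eps)
    finally show ?thesis
      by (simp add: measure_measure_pmf_finite sum.reindex inj_on_subset[OF inj])
  qed
  \<comment> \<open>The smallest atom \<open>s 1\<close> serves as the lower bound of the support,
    which makes \<open>l\<close> the common rate.\<close>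
  have "mellin_conv (measure_pmf P) (Erlang \<xi> (real \<xi>)) = cdf (erlang_mixture l A)"
    using mellin_conv_Erlang[of "real \<xi>" "s 1" P r] s_pos mono support
    by (auto simp: fun_eq_iff l_def A_def \<xi>)
  then have H: "interval_measure (mellin_conv (measure_pmf P) (Erlang \<xi> (real \<xi>))) = erlang_mixture l A"
    by (simp add: real_distribution.interval_measure_cdf[OF real_distribution_erlang_mixture[OF l]])
  have \<zeta>: "\<zeta> = (\<Sum>k\<le>N1. q k)" "\<zeta> \<le> 1"
    using poisson_cdf_le_1[OF lu(1)] by (simp_all add: \<zeta>_def poisson_cdf_def q_def)
  have q: "0 \<le> q k" for k using lu by (simp add: q_def)
  have D: "0 \<le> \<epsilon>1 * (\<rho> / (1 - \<rho>))" using \<rho> eps0 by simp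
  have trunc: "psi_trunc \<rho> P s \<xi> N1 N2 u = (\<Sum>k\<le>N1. q k * kappa_trunc \<rho> P s \<xi> N2 k)"
    by (simp add: psi_trunc_def sum_distrib_left q_def lu(2) power_divide power_mult_distrib ac_simps)
  have "psi \<rho> (mellin_conv (measure_pmf P) (Erlang \<xi> (real \<xi>))) u - psi_trunc \<rho> P s \<xi> N1 N2 u
      \<le> (\<Sum>k\<le>N1. q k * compound_tail \<rho> A k) + \<rho> * (1 - \<zeta>) - (\<Sum>k\<le>N1. q k * kappa_trunc \<rho> P s \<xi> N2 k)"
    using psi_erlang_mixture_le[OF H l u_nonneg \<rho>, of N1] unfolding trunc by (simp add: q_def \<zeta>_def)
  also have "\<dots> = (\<Sum>k\<le>N1. q k * (compound_tail \<rho> A k - kappa_trunc \<rho> P s \<xi> N2 k)) + \<rho> * (1 - \<zeta>)"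
    by (simp add: right_diff_distrib sum_subtractf)
  \<comment> \<open>The renewal comparison bounds every coefficient difference uniformly in
    \<open>k\<close>, and the factor \<rho> of the Poisson remainder is enlarged to 1. The weights
    \<open>q k\<close> then sum to \<zeta>, which is at most 1.\<close>
  also have "\<dots> \<le> (\<Sum>k\<le>N1. q k * (\<epsilon>1 * (\<rho> / (1 - \<rho>)))) + 1 * (1 - \<zeta>)"
    using \<rho> \<zeta> q compound_tail_minus_kappa_trunc_le[where s=s, OF \<rho> p inj mass eps0, of r]
    by (intro add_mono sum_mono mult_left_mono mult_right_mono) (simp_all add: A_def \<xi>)
  also have "\<dots> = \<zeta> * (\<epsilon>1 * (\<rho> / (1 - \<rho>))) + (1 - \<zeta>)"
    by (simp only: sum_distrib_right \<zeta>(1) mult_1)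
  also have "\<dots> \<le> 1 * (\<epsilon>1 * (\<rho> / (1 - \<rho>))) + (1 - \<zeta>)"
    using \<zeta> D by (intro add_right_mono mult_right_mono)
  also have "\<dots> \<le> \<epsilon>1 * (\<rho> / (1 - \<rho>) * (l * u) + 2 / (1 - \<rho>)\<^sup>2 * exp (- ((1 - \<rho>) * (l * u)))) + (1 - \<zeta>)"
    unfolding mult_1 using geometric_mean_le_linear_plus_exp[OF \<rho> lu(1)] eps0
    by (intro add_right_mono mult_left_mono)
  finally show ?thesis
    by (simp add: \<rho>_def \<zeta>_def lu(2))
qed

end
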